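(* Let $s=3$. For any $\mathfrak N\in\mathbb N$, any partition $\mathcal P_{\mathfrak N}=\{t_n\}_{n=0}^{\mathfrak N}$ of $[0,t_f]$, and any $n\in\{0,\dots,\mathfrak N-1\}$, the solution of the three-stage DIRK scheme $$v_{n,i}=u_n+\tau_n\sum_{j=1}^i a_{ij}\mathscr F_{n,j}\ (i=1,2,3),\qquad u_{n+1}=u_n+\tau_n\sum_{j=1}^3 b_j\mathscr F_{n,j},$$ with $a_{ii}>0$ for $i=1,2,3$, satisfies, with $v_{n,0}=u_n$, $$\tfrac12|u_{n+1}|^2+\sum_{i=1}^3\delta_i|v_{n,i}-v_{n,i-1}|^2-\tau_n\sum_{i=1}^3\nu_{ii}\langle\mathscr F_{n,i},v_{n,i}\rangle=\tfrac12|u_n|^2+\tau_n\left[\nu_{12}\langle\mathscr F_{n,1},v_{n,2}\rangle+\nu_{13}\langle\mathscr F_{n,1},v_{n,3}\rangle+\nu_{23}\langle\mathscr F_{n,2},v_{n,3}\rangle\right],$$ where $$\lambda_1=\frac{b_1}{a_{11}}-\frac{b_2a_{21}}{a_{11}a_{22}}-\frac{b_3a_{31}}{a_{11}a_{33}}+\frac{b_3a_{32}a_{21}}{a_{11}a_{22}a_{33}},\quad \lambda_2=\frac{b_2}{a_{22}}-\frac{b_3a_{32}}{a_{22}a_{33}},\quad \lambda_3=\frac{b_3}{a_{33}},$$ and $$\begin{aligned}\delta_1&=\tfrac12(\lambda_1+\lambda_2+\lambda_3)(2-\lambda_1-\lambda_2-\lambda_3),\\ \delta_2&=\tfrac12(\lambda_2+\lambda_3)(2-\lambda_2-\lambda_3),\\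 \delta_3&=\tfrac12\lambda_3(2-\lambda_3),\\ \nu_{11}&=a_{11}\big(\lambda_1(1-\lambda_2-\lambda_3)+(2-\lambda_2-\lambda_3)(\lambda_2+\lambda_3)\big),\\ \nu_{22}&=a_{22}\big(\lambda_2(1-\lambda_3)+(2-\lambda_3)\lambda_3\big),\\ \nu_{33}&=a_{33}\lambda_3,\\ \nu_{12}&=a_{21}\big(\lambda_2(1-\lambda_3)+(2-\lambda_3)\lambda_3\big)+a_{11}\big(\lambda_2(-2+\lambda_1+\lambda_2)+2(-1+\lambda_2)\lambda_3+\lambda_3^2\big),\\ \nu_{13}&=\lambda_3\big(a_{31}+a_{11}\lambda_1+a_{21}(-2+\lambda_2+\lambda_3)\big),\\ \nu_{23}&=\lambda_3\big(a_{32}+a_{22}(-2+\lambda_2+\lambda_3)\big).\end{aligned}$$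
   Context: $\mathbb V\subset\mathbb H\subset\mathbb V^*$ is a Gelfand triple: $\mathbb H$ is a separable (real) Hilbert space with inner product $(\cdot,\cdot)$ and norm $|\cdot|$; $\mathbb V$ is a Banach space with dual $\mathbb V^*$ and duality pairing $\langle\cdot,\cdot\rangle$; every $v\in\mathbb H$ is identified with the element of $\mathbb V^*$ given by $\langle v,w\rangle=(v,w)$ for all $w\in\mathbb V$. Let $t_f>0$, $u_0\in\mathbb H$, $f:[0,t_f]\to\mathbb V^*$ and $\mathcal A:\mathbb V\to\mathbb V^*$; the problem approximated is $\frac{du}{dt}=f(t)-\mathcal A(u)$ on $(0,t_f]$, $u(0)=u_0$. Standing assumptions on $\mathcal A$: $\langle\mathcal A(w),w\rangle\ge0$ for all $w\in\mathbb V$, and (local solvability) for every $F\in\mathbb V^*$ there is $\beta>0$ such that for all $\gamma\in(0,\beta]$ the problem $v+\gamma\mathcal A(v)=F$ has a unique solution $v\in\mathbb V$. A partition is $0=t_0<\dots<t_{\mathfrak N}=t_f$ and $\tau_n=t_{n+1}-t_n$. The Runge-Kutta scheme has tableau with coefficient matrix $\mathbf A=[a_{ij}]$ (lower triangular, i.e. DIRK), weights $b_i\in[0,1]$ and nodes $c_i\in[0,1]$. Here $\mathscr F_{n,j}=f(t_n+c_j\tau_n)-\mathcal A(v_{n,j})$. The scheme equations hold in $\mathbb V^*$, with $u_n\in\mathbb H$, stages $v_{n,i}\in\mathbb V$ and $u_{n+1}\in\mathbb H$. *)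

theory Defs
  imports "HOL-Analysis.Analysis"
begin

type_synonym 'v dual = "'v \<Rightarrow>\<^sub>L real"

text \<open>
  The inclusion of the Banach space V into the Hilbert space H is a bounded linear map
  between two types; it has to be injective with dense range.
\<close>

definition gelfand_triple :: "('v::banach \<Rightarrow>\<^sub>L 'h::{real_inner, complete_space}) \<Rightarrow> bool" where
  "gelfand_triple emb \<longleftrightarrow>
     inj (blinfun_apply emb) \<and> closure (range (blinfun_apply emb)) = UNIV \<and>
     (\<exists>D :: 'h set. countable D \<and> closure D = UNIV)"

text \<open>The identification of \<open>h\<close> in H with the functional \<open>w \<mapsto> (h, w)\<close> on V.\<close>

definition to_dual :: "('v::banach \<Rightarrow>\<^sub>L 'h::{real_inner, complete_space}) \<Rightarrow> 'h \<Rightarrow> 'v dual" where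
  "to_dual emb h = blinfun_inner_right h o\<^sub>L emb"

lemma to_dual_apply: "blinfun_apply (to_dual emb h) w = h \<bullet> blinfun_apply emb w"
  by (simp add: to_dual_def)

definition nonneg_operator :: "('v::banach \<Rightarrow> 'v dual) \<Rightarrow> bool" where
  "nonneg_operator A \<longleftrightarrow> (\<forall>w. 0 \<le> blinfun_apply (A w) w)"

definition locally_solvable ::
  "('v::banach \<Rightarrow>\<^sub>L 'h::{real_inner, complete_space}) \<Rightarrow> ('v \<Rightarrow> 'v dual) \<Rightarrow> bool" where
  "locally_solvable emb A \<longleftrightarrow>
     (\<forall>F :: 'v dual. \<exists>\<beta>>0. \<forall>\<gamma>. 0 < \<gamma> \<and> \<gamma> \<le> \<beta> \<longrightarrow>
        (\<exists>!v. to_dual emb (blinfun_apply emb v) + \<gamma> *\<^sub>R A v = F))"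

definition is_partition :: "real \<Rightarrow> nat \<Rightarrow> (nat \<Rightarrow> real) \<Rightarrow> bool" where
  "is_partition tf N t \<longleftrightarrow> t 0 = 0 \<and> t N = tf \<and> (\<forall>n<N. t n < t (Suc n))"

definition step_size :: "(nat \<Rightarrow> real) \<Rightarrow> nat \<Rightarrow> real" where
  "step_size t n = t (Suc n) - t n"

definition dirk_tableau ::
  "nat \<Rightarrow> (nat \<Rightarrow> nat \<Rightarrow> real) \<Rightarrow> (nat \<Rightarrow> real) \<Rightarrow> (nat \<Rightarrow> real) \<Rightarrow> bool" where
  "dirk_tableau s a b c \<longleftrightarrow>
     (\<forall>i\<in>{1..s}. \<forall>j\<in>{1..s}. i < j \<longrightarrow> a i j = 0) \<and>
     (\<forall>i\<in>{1..s}. b i \<in> {0..1} \<and> c i \<in> {0..1})"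

definition stage_slope ::
  "(real \<Rightarrow> 'v::banach dual) \<Rightarrow> ('v \<Rightarrow> 'v dual) \<Rightarrow> (nat \<Rightarrow> real) \<Rightarrow> (nat \<Rightarrow> real) \<Rightarrow>
   (nat \<Rightarrow> nat \<Rightarrow> 'v) \<Rightarrow> nat \<Rightarrow> nat \<Rightarrow> 'v dual" where
  "stage_slope f A c t v n j = f (t n + c j * step_size t n) - A (v n j)"

text \<open>
  Stages are numbered from 1 to \<open>s\<close>; \<open>v n 0\<close> is not used. The equations hold in the dual of V.
\<close>

definition dirk_solution ::
  "('v::banach \<Rightarrow>\<^sub>L 'h::{real_inner, complete_space}) \<Rightarrow> (real \<Rightarrow> 'v dual) \<Rightarrow> ('v \<Rightarrow> 'v dual) \<Rightarrow>
   'h \<Rightarrow> nat \<Rightarrow> (nat \<Rightarrow> nat \<Rightarrow> real) \<Rightarrow> (nat \<Rightarrow> real) \<Rightarrow> (nat \<Rightarrow> real) \<Rightarrow>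
   nat \<Rightarrow> (nat \<Rightarrow> real) \<Rightarrow> (nat \<Rightarrow> 'h) \<Rightarrow> (nat \<Rightarrow> nat \<Rightarrow> 'v) \<Rightarrow> bool" where
  "dirk_solution emb f A u0 s a b c N t u v \<longleftrightarrow>
     u 0 = u0 \<and>
     (\<forall>n<N.
        (\<forall>i\<in>{1..s}. to_dual emb (blinfun_apply emb (v n i)) =
           to_dual emb (u n) + step_size t n *\<^sub>R (\<Sum>j=1..i. a i j *\<^sub>R stage_slope f A c t v n j)) \<and>
        to_dual emb (u (Suc n)) =
           to_dual emb (u n) + step_size t n *\<^sub>R (\<Sum>j=1..s. b j *\<^sub>R stage_slope f A c t v n j))"

text \<open>The stages as elements of H, with the convention that the stage of index 0 is \<open>u n\<close>.\<close>

definition stage_in_H ::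
  "('v::banach \<Rightarrow>\<^sub>L 'h::{real_inner, complete_space}) \<Rightarrow> (nat \<Rightarrow> 'h) \<Rightarrow> (nat \<Rightarrow> nat \<Rightarrow> 'v) \<Rightarrow>
   nat \<Rightarrow> nat \<Rightarrow> 'h" where
  "stage_in_H emb u v n i = (if i = 0 then u n else blinfun_apply emb (v n i))"

end

theory Submission
  imports Defs
begin

text \<open>
  As \<open>V\<close> is dense in \<open>H\<close>, the identification of \<open>H\<close> with a subspace of the dual of \<open>V\<close> is
  injective. The diagonal of the tableau is nonzero, so the stage equations can be solved for the
  slopes, and every \<open>\<tau>F\<^sub>i\<close> is therefore represented by a vector \<open>g\<^sub>i\<close> of \<open>H\<close>. The scheme then
  holds in \<open>H\<close>, and all pairings become inner products. The \<open>\<lambda>\<^sub>i\<close> solve \<open>b\<^sub>j = \<Sum>\<^sub>i a\<^sub>i\<^sub>j \<lambda>\<^sub>i\<close>, so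
  \<open>u\<^sub>n\<^sub>+\<^sub>1 = u\<^sub>n + \<Sum>\<^sub>i s\<^sub>i (v\<^sub>i - v\<^sub>i\<^sub>-\<^sub>1)\<close> with \<open>s\<^sub>i = \<lambda>\<^sub>i + \<dots> + \<lambda>\<^sub>3\<close>. Expanding \<open>|u\<^sub>n\<^sub>+\<^sub>1|\<^sup>2\<close> in these
  increments and writing them in terms of the \<open>g\<^sub>i\<close> gives the identity.
\<close>

lemma to_dual_add: "to_dual emb (x + y) = to_dual emb x + to_dual emb y"
  by (rule blinfun_eqI) (simp add: to_dual_apply blinfun.add_left inner_add_left)

lemma to_dual_scaleR: "to_dual emb (r *\<^sub>R x) = r *\<^sub>R to_dual emb x"
  by (rule blinfun_eqI) (simp add: to_dual_apply blinfun.scaleR_left)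

lemma linear_to_dual: "linear (to_dual emb)"
  by (rule linearI) (rule to_dual_add to_dual_scaleR)+

text \<open>A vector in the kernel is orthogonal to the range of \<open>emb\<close>. Its orthogonal
  hyperplane is closed, so by density it is all of H, and the vector is orthogonal to
  itself.\<close>

lemma inj_to_dual:
  assumes "closure (range (blinfun_apply emb)) = UNIV"
  shows "inj (to_dual emb)"
  unfolding linear_injective_0[OF linear_to_dual]
proof (intro allI impI)
  fix z assume "to_dual emb z = 0"
  hence zero: "z \<bullet> blinfun_apply emb x = 0" for x
    by (metis to_dual_apply zero_blinfun.rep_eq)
  have "closure (range (blinfun_apply emb)) \<subseteq> {y. z \<bullet> y = 0}"
    by (rule closure_minimal) (auto simp: zero closed_hyperplane)
  hence "z \<bullet> z = 0"
    unfolding assms by blast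
  thus "z = 0"
    by simp
qed

text \<open>The tableau is triangular, so stage \<open>i\<close> expresses \<open>a i i\<close>
  times the scaled slope through elements of the range and earlier slopes; strong induction applies.
  Keeping the factor \<open>\<tau>\<close> with the slope avoids dividing by it.\<close>

lemma slope_in_range_to_dual:
  fixes i s :: nat
  assumes stage: "\<And>i. i \<in> {1..s} \<Longrightarrow>
      to_dual emb (V i) = to_dual emb U + \<tau> *\<^sub>R (\<Sum>j=1..i. a i j *\<^sub>R F j)"
    and diag: "\<And>i. i \<in> {1..s} \<Longrightarrow> a i i \<noteq> 0"
    and "i \<in> {1..s}"
  shows "\<tau> *\<^sub>R F i \<in> range (to_dual emb)"
  using \<open>i \<in> {1..s}\<close>
proof (induction i rule: less_induct)
  case (less i)
  let ?R = "range (to_dual emb)"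
  have R: "subspace ?R"
    by (rule linear_subspace_image[OF linear_to_dual subspace_UNIV])
  have "(\<Sum>j=1..i. a i j *\<^sub>R F j) = (\<Sum>j=1..<i. a i j *\<^sub>R F j) + a i i *\<^sub>R F i"
    using less.prems by (simp add: atLeastLessThanSuc_atLeastAtMost[symmetric])
  hence "a i i *\<^sub>R (\<tau> *\<^sub>R F i) =
      to_dual emb (V i) - to_dual emb U - (\<Sum>j=1..<i. a i j *\<^sub>R (\<tau> *\<^sub>R F j))"
    using stage[OF less.prems]
    by (simp add: scaleR_add_right scaleR_sum_right mult.commute)
  moreover have "(\<Sum>j=1..<i. a i j *\<^sub>R (\<tau> *\<^sub>R F j)) \<in> ?R"
  proof (rule subspace_sum[OF R])
    show "a i j *\<^sub>R (\<tau> *\<^sub>R F j) \<in> ?R" if "j \<in> {1..<i}" for j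
      using less.IH[of j] less.prems that by (intro subspace_scale[OF R, of "\<tau> *\<^sub>R F j"]) auto
  qed
  ultimately have "a i i *\<^sub>R (\<tau> *\<^sub>R F i) \<in> ?R"
    by (simp add: subspace_diff[OF R])
  hence "inverse (a i i) *\<^sub>R (a i i *\<^sub>R (\<tau> *\<^sub>R F i)) \<in> ?R"
    by (rule subspace_scale[OF R])
  thus ?case
    using diag[OF less.prems] by (simp add: mult.assoc[symmetric])
qed

text \<open>With \<open>d\<^sub>i\<close> the increments, expand the square of \<open>W\<close> and
  replace \<open>d\<^sub>i \<bullet> V0\<close> by \<open>d\<^sub>i \<bullet> V\<^sub>i\<close>
  minus the products of \<open>d\<^sub>i\<close> with \<open>d\<^sub>1\<close>, ...,
  \<open>d\<^sub>i\<close>. The square of \<open>d\<^sub>i\<close> then has coefficient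
  \<open>s\<^sub>i\<^sup>2 / 2 - s\<^sub>i\<close>, and \<open>d\<^sub>j \<bullet> d\<^sub>i\<close>
  with \<open>j < i\<close> has \<open>s\<^sub>i * (s\<^sub>j - 1)\<close>.\<close>

lemma three_increment_energy:
  fixes V0 V1 V2 V3 :: "'h::real_inner"
  assumes W: "W = V0 + s1 *\<^sub>R (V1 - V0) + s2 *\<^sub>R (V2 - V1) + s3 *\<^sub>R (V3 - V2)"
  shows "1/2 * (norm W)\<^sup>2
      + 1/2 * s1 * (2 - s1) * (norm (V1 - V0))\<^sup>2
      + 1/2 * s2 * (2 - s2) * (norm (V2 - V1))\<^sup>2
      + 1/2 * s3 * (2 - s3) * (norm (V3 - V2))\<^sup>2
    = 1/2 * (norm V0)\<^sup>2
      + s1 * ((V1 - V0) \<bullet> V1) + s2 * ((V2 - V1) \<bullet> V2) + s3 * ((V3 - V2) \<bullet> V3)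
      + s2 * (s1 - 1) * ((V1 - V0) \<bullet> (V2 - V1)) + s3 * (s1 - 1) * ((V1 - V0) \<bullet> (V3 - V2))
      + s3 * (s2 - 1) * ((V2 - V1) \<bullet> (V3 - V2))"
proof -
  define d1 d2 d3 where d: "d1 = V1 - V0" "d2 = V2 - V1" "d3 = V3 - V2"
  have V: "V1 = V0 + d1" "V2 = V0 + d1 + d2" "V3 = V0 + d1 + d2 + d3"
    by (simp_all add: d)
  have comm: "d1 \<bullet> V0 = V0 \<bullet> d1" "d2 \<bullet> V0 = V0 \<bullet> d2" "d3 \<bullet> V0 = V0 \<bullet> d3"
    "d2 \<bullet> d1 = d1 \<bullet> d2" "d3 \<bullet> d1 = d1 \<bullet> d3" "d3 \<bullet> d2 = d2 \<bullet> d3"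
    by (simp_all add: inner_commute)
  show ?thesis
    unfolding W d[symmetric] power2_norm_eq_inner
    unfolding V
    by (simp only: inner_add_left inner_add_right inner_scaleR_left inner_scaleR_right comm)
      (simp add: field_simps)
qed

text \<open>The squared increments stay as they are, while all other products of increments become
  pairings of some \<open>g\<^sub>i\<close> with a stage. Collecting their coefficients produces the
  \<open>\<nu>\<close> of the theorem.\<close>

lemma three_stage_energy_identity:
  fixes U g1 g2 g3 :: "'h::real_inner"
  assumes V1: "V1 = U + a11 *\<^sub>R g1"
    and V2: "V2 = U + a21 *\<^sub>R g1 + a22 *\<^sub>R g2"
    and V3: "V3 = U + a31 *\<^sub>R g1 + a32 *\<^sub>R g2 + a33 *\<^sub>R g3"
    and W: "W = U + (a11 * l1 + a21 * l2 + a31 * l3) *\<^sub>R g1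
                  + (a22 * l2 + a32 * l3) *\<^sub>R g2 + (a33 * l3) *\<^sub>R g3"
  shows "1/2 * (norm W)\<^sup>2
      + (1/2 * (l1 + l2 + l3) * (2 - l1 - l2 - l3) * (norm (V1 - U))\<^sup>2
         + 1/2 * (l2 + l3) * (2 - l2 - l3) * (norm (V2 - V1))\<^sup>2
         + 1/2 * l3 * (2 - l3) * (norm (V3 - V2))\<^sup>2)
      - (a11 * (l1 * (1 - l2 - l3) + (2 - l2 - l3) * (l2 + l3)) * (g1 \<bullet> V1)
         + a22 * (l2 * (1 - l3) + (2 - l3) * l3) * (g2 \<bullet> V2)
         + a33 * l3 * (g3 \<bullet> V3))
    = 1/2 * (norm U)\<^sup>2
      + ((a21 * (l2 * (1 - l3) + (2 - l3) * l3)
            + a11 * (l2 * (-2 + l1 + l2) + 2 * (-1 + l2) * l3 + l3\<^sup>2)) * (g1 \<bullet> V2)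
         + l3 * (a31 + a11 * l1 + a21 * (-2 + l2 + l3)) * (g1 \<bullet> V3)
         + l3 * (a32 + a22 * (-2 + l2 + l3)) * (g2 \<bullet> V3))"
proof -
  have d1: "V1 - U = a11 *\<^sub>R g1"
    and d2: "V2 - V1 = (a21 - a11) *\<^sub>R g1 + a22 *\<^sub>R g2"
    and d3: "V3 - V2 = (a31 - a21) *\<^sub>R g1 + (a32 - a22) *\<^sub>R g2 + a33 *\<^sub>R g3"
    by (simp_all add: V1 V2 V3 algebra_simps)
  \<comment> \<open>Here \<open>W - U\<close> is the sum of the
    \<open>l\<^sub>i *\<^sub>R (V\<^sub>i - U)\<close>; summation by parts turns the weights into
    tail sums.\<close>
  have "W = U + (l1 + l2 + l3) *\<^sub>R (V1 - U) + (l2 + l3) *\<^sub>R (V2 - V1) + l3 *\<^sub>R (V3 - V2)"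
    unfolding W d1 d2 d3 by (simp add: algebra_simps)
  note energy = three_increment_energy[OF this]
  have diag: "(V1 - U) \<bullet> V1 = a11 * (g1 \<bullet> V1)"
    "(V2 - V1) \<bullet> V2 = (a21 - a11) * (g1 \<bullet> V2) + a22 * (g2 \<bullet> V2)"
    "(V3 - V2) \<bullet> V3 = (a31 - a21) * (g1 \<bullet> V3) + (a32 - a22) * (g2 \<bullet> V3) + a33 * (g3 \<bullet> V3)"
    unfolding d1 d2 d3 by (simp_all add: inner_add_left)
  \<comment> \<open>Expanding only the left factor keeps every cross term linear in the pairings \<open>g\<^sub>i \<bullet> V\<^sub>j\<close>
    with \<open>i \<le> j\<close>.\<close>
  have cross: "(V1 - U) \<bullet> (V2 - V1) = a11 * (g1 \<bullet> V2 - g1 \<bullet> V1)"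
    "(V1 - U) \<bullet> (V3 - V2) = a11 * (g1 \<bullet> V3 - g1 \<bullet> V2)"
    "(V2 - V1) \<bullet> (V3 - V2)
      = (a21 - a11) * (g1 \<bullet> V3 - g1 \<bullet> V2) + a22 * (g2 \<bullet> V3 - g2 \<bullet> V2)"
    by (subst inner_diff_right, simp add: d1 d2 inner_add_left algebra_simps)+
  have "2 - l1 - l2 - l3 = 2 - (l1 + l2 + l3)" "2 - l2 - l3 = 2 - (l2 + l3)"
    by simp_all
  with energy show ?thesis
    unfolding diag cross by (simp add: algebra_simps power2_eq_square)
qed

theorem theorem5p3:
  fixes emb :: "'v::banach \<Rightarrow>\<^sub>L 'h::{real_inner, complete_space}"
    and f :: "real \<Rightarrow> 'v dual" and A :: "'v \<Rightarrow> 'v dual" and u0 :: 'h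
    and tf :: real and N n :: nat and t :: "nat \<Rightarrow> real"
    and a :: "nat \<Rightarrow> nat \<Rightarrow> real" and b c :: "nat \<Rightarrow> real"
    and u :: "nat \<Rightarrow> 'h" and v :: "nat \<Rightarrow> nat \<Rightarrow> 'v"
    and lam \<delta> :: "nat \<Rightarrow> real" and \<nu> :: "nat \<Rightarrow> nat \<Rightarrow> real"
    and \<tau> :: real and F :: "nat \<Rightarrow> 'v dual" and w :: "nat \<Rightarrow> 'h"
  assumes "gelfand_triple emb"
    and "nonneg_operator A"
    and "locally_solvable emb A"
    and "tf > 0"
    and "is_partition tf N t"
    and "n < N"
    and "dirk_tableau 3 a b c"
    and "\<forall>i\<in>{1..3}. a i i > 0"
    and "dirk_solution emb f A u0 3 a b c N t u v"
  defines "\<tau> \<equiv> step_size t n"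
    and "F \<equiv> stage_slope f A c t v n"
    and "w \<equiv> stage_in_H emb u v n"
  assumes "lam 1 = b 1 / a 1 1 - b 2 * a 2 1 / (a 1 1 * a 2 2) - b 3 * a 3 1 / (a 1 1 * a 3 3)
                    + b 3 * a 3 2 * a 2 1 / (a 1 1 * a 2 2 * a 3 3)"
    and "lam 2 = b 2 / a 2 2 - b 3 * a 3 2 / (a 2 2 * a 3 3)"
    and "lam 3 = b 3 / a 3 3"
    and "\<delta> 1 = 1/2 * (lam 1 + lam 2 + lam 3) * (2 - lam 1 - lam 2 - lam 3)"
    and "\<delta> 2 = 1/2 * (lam 2 + lam 3) * (2 - lam 2 - lam 3)"
    and "\<delta> 3 = 1/2 * lam 3 * (2 - lam 3)"
    and "\<nu> 1 1 = a 1 1 * (lam 1 * (1 - lam 2 - lam 3) + (2 - lam 2 - lam 3) * (lam 2 + lam 3))"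
    and "\<nu> 2 2 = a 2 2 * (lam 2 * (1 - lam 3) + (2 - lam 3) * lam 3)"
    and "\<nu> 3 3 = a 3 3 * lam 3"
    and "\<nu> 1 2 = a 2 1 * (lam 2 * (1 - lam 3) + (2 - lam 3) * lam 3)
                + a 1 1 * (lam 2 * (-2 + lam 1 + lam 2) + 2 * (-1 + lam 2) * lam 3 + (lam 3)^2)"
    and "\<nu> 1 3 = lam 3 * (a 3 1 + a 1 1 * lam 1 + a 2 1 * (-2 + lam 2 + lam 3))"
    and "\<nu> 2 3 = lam 3 * (a 3 2 + a 2 2 * (-2 + lam 2 + lam 3))"
  shows "1/2 * (norm (u (Suc n)))^2 + (\<Sum>i=1..3. \<delta> i * (norm (w i - w (i - 1)))^2)
           - \<tau> * (\<Sum>i=1..3. \<nu> i i * blinfun_apply (F i) (v n i))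
         = 1/2 * (norm (u n))^2
           + \<tau> * (\<nu> 1 2 * blinfun_apply (F 1) (v n 2) + \<nu> 1 3 * blinfun_apply (F 1) (v n 3)
                  + \<nu> 2 3 * blinfun_apply (F 2) (v n 3))"
proof -
  note diag = assms(8) and lam = assms(13-15) and coeffs = assms(16-24)
  note sol = assms(9)[unfolded dirk_solution_def, THEN conjunct2, rule_format, OF \<open>n < N\<close>,
      folded \<tau>_def F_def]
  define V where "V i = blinfun_apply emb (v n i)" for i
  have stage: "to_dual emb (V i) = to_dual emb (u n) + \<tau> *\<^sub>R (\<Sum>j=1..i. a i j *\<^sub>R F j)"
    if "i \<in> {1..3}" for i
    using sol that by (simp add: V_def)
  have update: "to_dual emb (u (Suc n)) = to_dual emb (u n) + \<tau> *\<^sub>R (\<Sum>j=1..3. b j *\<^sub>R F j)"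
    using sol by simp
  have inj: "inj (to_dual emb)"
    using assms(1) by (auto simp: gelfand_triple_def intro: inj_to_dual)
  have slope: "\<tau> *\<^sub>R F i \<in> range (to_dual emb)" if "i \<in> {1..3}" for i
  proof (rule slope_in_range_to_dual[OF stage _ that])
    show "a j j \<noteq> 0" if "j \<in> {1..3}" for j
      using bspec[OF diag that] by simp
  qed
  define g where "g i = inv (to_dual emb) (\<tau> *\<^sub>R F i)" for i
  have g: "to_dual emb (g i) = \<tau> *\<^sub>R F i" if "i \<in> {1..3}" for i
    unfolding g_def by (rule f_inv_into_f[OF slope[OF that]])
  \<comment> \<open>Injectivity moves an equation from the dual of V to H. Arbitrary weights
    \<open>r\<close> let this serve both the stages and the update.\<close>
  have H_eq: "x = u n + (\<Sum>j\<in>J. r j *\<^sub>R g j)"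
    if "to_dual emb x = to_dual emb (u n) + \<tau> *\<^sub>R (\<Sum>j\<in>J. r j *\<^sub>R F j)" "J \<subseteq> {1..3}" for x J r
  proof (rule injD[OF inj])
    show "to_dual emb x = to_dual emb (u n + (\<Sum>j\<in>J. r j *\<^sub>R g j))"
      unfolding that(1) to_dual_add linear_sum[OF linear_to_dual] to_dual_scaleR scaleR_sum_right
      using that(2) g by (auto intro!: sum.cong simp: mult.commute)
  qed
  have stage_H: "V i = u n + (\<Sum>j=1..i. a i j *\<^sub>R g j)" if "i \<in> {1..3}" for i
    using H_eq[OF stage[OF that]] that by simp
  have sums: "{1..1} = {1::nat}" "{1..2} = {1, 2::nat}" "{1..3} = {1, 2, 3::nat}"
    by auto
  have V1: "V 1 = u n + a 1 1 *\<^sub>R g 1"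
    and V2: "V 2 = u n + a 2 1 *\<^sub>R g 1 + a 2 2 *\<^sub>R g 2"
    and V3: "V 3 = u n + a 3 1 *\<^sub>R g 1 + a 3 2 *\<^sub>R g 2 + a 3 3 *\<^sub>R g 3"
    using stage_H[of 1] stage_H[of 2] stage_H[of 3] unfolding sums by (simp_all add: add.assoc)
  have "u (Suc n) = u n + (\<Sum>j=1..3. b j *\<^sub>R g j)"
    using H_eq[OF update] by simp
  moreover have "a 1 1 \<noteq> 0" "a 2 2 \<noteq> 0" "a 3 3 \<noteq> 0"
    using diag[rule_format, of 1] diag[rule_format, of 2] diag[rule_format, of 3] by simp_all
  \<comment> \<open>The \<open>lam i\<close> come from back substitution in the transposed tableau,
    starting with \<open>lam 3\<close>.\<close>
  hence "b 1 = a 1 1 * lam 1 + a 2 1 * lam 2 + a 3 1 * lam 3"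
    and "b 2 = a 2 2 * lam 2 + a 3 2 * lam 3" and "b 3 = a 3 3 * lam 3"
    unfolding lam by (simp_all add: field_simps)
  ultimately have W: "u (Suc n) = u n + (a 1 1 * lam 1 + a 2 1 * lam 2 + a 3 1 * lam 3) *\<^sub>R g 1
      + (a 2 2 * lam 2 + a 3 2 * lam 3) *\<^sub>R g 2 + (a 3 3 * lam 3) *\<^sub>R g 3"
    unfolding sums by (simp add: add.assoc)
  \<comment> \<open>The step size is absorbed into \<open>g i\<close>, and \<open>k\<close> is free
    because the pairings in the identity also mix slopes with later stages.\<close>
  have pairing: "g i \<bullet> V k = \<tau> * blinfun_apply (F i) (v n k)" if "i \<in> {1..3}" for i k
    using to_dual_apply[of emb "g i" "v n k"] g[OF that]
    by (simp add: V_def blinfun.scaleR_left)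
  \<comment> \<open>The value at index 0 makes the first increment start from
    \<open>u n\<close>.\<close>
  have w: "w 0 = u n" "w 1 = V 1" "w 2 = V 2" "w 3 = V 3"
    by (simp_all add: w_def stage_in_H_def V_def)
  have increments: "(\<Sum>i=1..3. \<delta> i * (norm (w i - w (i - 1)))\<^sup>2)
      = \<delta> 1 * (norm (V 1 - u n))\<^sup>2 + \<delta> 2 * (norm (V 2 - V 1))\<^sup>2 + \<delta> 3 * (norm (V 3 - V 2))\<^sup>2"
    unfolding sums using w by simp
  have diagonal: "\<tau> * (\<Sum>i=1..3. \<nu> i i * blinfun_apply (F i) (v n i))
      = \<nu> 1 1 * (g 1 \<bullet> V 1) + \<nu> 2 2 * (g 2 \<bullet> V 2) + \<nu> 3 3 * (g 3 \<bullet> V 3)"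
    unfolding sums by (simp add: pairing algebra_simps)
  have off_diagonal: "\<tau> * (\<nu> 1 2 * blinfun_apply (F 1) (v n 2)
        + \<nu> 1 3 * blinfun_apply (F 1) (v n 3) + \<nu> 2 3 * blinfun_apply (F 2) (v n 3))
      = \<nu> 1 2 * (g 1 \<bullet> V 2) + \<nu> 1 3 * (g 1 \<bullet> V 3) + \<nu> 2 3 * (g 2 \<bullet> V 3)"
    by (simp add: pairing algebra_simps)
  show ?thesis
    unfolding increments diagonal off_diagonal
    unfolding coeffs
    by (rule three_stage_energy_identity[OF V1 V2 V3 W])
qed

end
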